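(* For every connected graph $G$, $\mathrm{Kc}(G^{**},4) = 1$, i.e., any two $4$-colorings of $G^{**}$ are Kempe equivalent.
   Context: All graphs are finite and simple. Given a graph $G$, the graph $G^{**}$ is constructed as follows. For each vertex $v$ of $G$ take an independent set $I_v$ of $\deg_G(v)$ new vertices, the sets $I_v$ pairwise disjoint. For each edge $uv$ of $G$, place one edge between a vertex of $I_u$ and a vertex of $I_v$, in such a way that all these edges are pairwise vertex-disjoint (so every vertex of $\bigcup_v I_v$ is incident to exactly one of them); call the result $G^*$. Then, for each vertex $v$ of $G$, add two new vertices $x_v,y_v$, joined to each other and to every vertex of $I_v$; the result is $G^{**}$. A $4$-coloring is a map $c:V\to\{1,2,3,4\}$ with adjacent vertices receiving different colors. For distinct colors $i,j$, a Kempe change swaps $i$ and $j$ on one connected component of the subgraph induced by vertices colored $i$ or $j$. Two $4$-colorings are Kempe equivalent if one is obtained from the other by a finite sequence of Kempe changes; $\mathrm{Kc}(H,4)$ denotes the number of Kempe equivalence classes of $4$-colorings of $H$. *)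

theory Defs
  imports
    "Graph_Theory.Digraph_Component"
    "HOL-Library.FuncSet"
    "HOL-Library.Disjoint_Sets"
    "HOL-Combinatorics.Transposition"
begin

text \<open>
  A finite simple graph is a \<^locale>\<open>pair_graph\<close>: a finite vertex set with a symmetric and
  irreflexive set of arcs, where an edge \<open>uv\<close> is the pair of arcs \<open>(u, v)\<close>, \<open>(v, u)\<close>.
  In particular the degree of a vertex is its \<^const>\<open>out_degree\<close>, and the connected components
  of a graph are its strongly connected components.

  The graphs \<open>G\<^sup>*\<close> and \<open>G\<^sup>*\<^sup>*\<close> involve choices (of the new vertices and of the endpoints of
  the matching edges), so they are given as relations: \<open>is_star G I S\<close> says that \<open>S\<close> is an
  outcome of the construction of \<open>G\<^sup>*\<close> with independent sets \<open>I v\<close>. The function \<open>e\<close> maps each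
  arc of \<open>G\<close> to the arc of \<open>S\<close> placed for it, reversed arcs going to reversed arcs.
\<close>

definition is_star :: "'a pair_pre_digraph \<Rightarrow> ('a \<Rightarrow> 'b set) \<Rightarrow> 'b pair_pre_digraph \<Rightarrow> bool" where
  "is_star G I S \<longleftrightarrow>
     (\<forall>v\<in>pverts G. finite (I v) \<and> card (I v) = out_degree (with_proj G) v) \<and>
     disjoint_family_on I (pverts G) \<and>
     pverts S = (\<Union>v\<in>pverts G. I v) \<and>
     (\<exists>e. (\<forall>(u, v)\<in>parcs G. e (u, v) \<in> I u \<times> I v \<and> e (v, u) = prod.swap (e (u, v))) \<and>
          (\<forall>a\<in>parcs G. \<forall>b\<in>parcs G. b \<noteq> a \<and> b \<noteq> prod.swap a \<longrightarrow>
             {fst (e a), snd (e a)} \<inter> {fst (e b), snd (e b)} = {}) \<and>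
          parcs S = e ` parcs G)"

definition is_double_star :: "'a pair_pre_digraph \<Rightarrow> 'b pair_pre_digraph \<Rightarrow> bool" where
  "is_double_star G H \<longleftrightarrow>
     (\<exists>I S x y A. is_star G I S \<and>
        inj_on x (pverts G) \<and> inj_on y (pverts G) \<and>
        x ` pverts G \<inter> y ` pverts G = {} \<and>
        (x ` pverts G \<union> y ` pverts G) \<inter> pverts S = {} \<and>
        A = (\<Union>v\<in>pverts G. {(x v, y v)} \<union> {x v, y v} \<times> I v) \<and>
        pverts H = pverts S \<union> x ` pverts G \<union> y ` pverts G \<and>
        parcs H = parcs S \<union> A \<union> A\<inverse>)"

text \<open>
  Colorings are extensional functions, so that two of them are equal iff they agree on the
  vertices.
\<close>

definition colorings :: "'a pair_pre_digraph \<Rightarrow> nat \<Rightarrow> ('a \<Rightarrow> nat) set" where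
  "colorings H k = {c \<in> pverts H \<rightarrow>\<^sub>E {1..k}. \<forall>(u, v)\<in>parcs H. c u \<noteq> c v}"

definition kempe_components :: "'a pair_pre_digraph \<Rightarrow> ('a \<Rightarrow> nat) \<Rightarrow> nat \<Rightarrow> nat \<Rightarrow> 'a set set" where
  "kempe_components H c i j =
     pre_digraph.sccs_verts (with_proj H \<restriction> {v \<in> pverts H. c v \<in> {i, j}})"

definition kempe_change :: "'a pair_pre_digraph \<Rightarrow> nat \<Rightarrow> (('a \<Rightarrow> nat) \<times> ('a \<Rightarrow> nat)) set" where
  "kempe_change H k =
     {(c, d). c \<in> colorings H k \<and>
        (\<exists>i\<in>{1..k}. \<exists>j\<in>{1..k}. i \<noteq> j \<and>
           (\<exists>K\<in>kempe_components H c i j. d = (\<lambda>v. if v \<in> K then transpose i j (c v) else c v)))}"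

definition kempe_equiv :: "'a pair_pre_digraph \<Rightarrow> nat \<Rightarrow> (('a \<Rightarrow> nat) \<times> ('a \<Rightarrow> nat)) set" where
  "kempe_equiv H k = (kempe_change H k)\<^sup>* \<inter> colorings H k \<times> colorings H k"

definition Kc :: "'a pair_pre_digraph \<Rightarrow> nat \<Rightarrow> nat" where
  "Kc H k = card (colorings H k // kempe_equiv H k)"


text \<open>The construction can always be carried out, and it yields a finite simple graph.\<close>

lemma is_double_star_exists:
  assumes "pair_graph G"
  shows "\<exists>H :: ('a \<times> 'a + 'a \<times> bool) pair_pre_digraph. is_double_star (G :: 'a pair_pre_digraph) H"
proof -
  interpret pair_graph G by fact
  define I :: "'a \<Rightarrow> ('a \<times> 'a + 'a \<times> bool) set" where "I v = Inl ` out_arcs (with_proj G) v" for v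
  define e :: "'a \<times> 'a \<Rightarrow> _" where
    "e a = (Inl a :: 'a \<times> 'a + 'a \<times> bool, Inl (prod.swap a) :: 'a \<times> 'a + 'a \<times> bool)" for a
  define S where "S = \<lparr>pverts = (\<Union>v\<in>pverts G. I v), parcs = e ` parcs G\<rparr>"
  define x y :: "'a \<Rightarrow> 'a \<times> 'a + 'a \<times> bool" where "x v = Inr (v, True)" and "y v = Inr (v, False)" for v
  define A where "A = (\<Union>v\<in>pverts G. {(x v, y v)} \<union> {x v, y v} \<times> I v)"
  have "is_star G I S"
    unfolding is_star_def
  proof (intro conjI exI[of _ e])
    show "\<forall>v\<in>pverts G. finite (I v) \<and> card (I v) = out_degree (with_proj G) v"
      by (auto simp: I_def out_degree_def card_image)
    show "disjoint_family_on I (pverts G)"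
      by (auto simp: disjoint_family_on_def I_def)
    show "\<forall>(u, v)\<in>parcs G. e (u, v) \<in> I u \<times> I v \<and> e (v, u) = prod.swap (e (u, v))"
      by (auto simp: e_def I_def arcs_symmetric)
    show "\<forall>a\<in>parcs G. \<forall>b\<in>parcs G. b \<noteq> a \<and> b \<noteq> prod.swap a \<longrightarrow>
             {fst (e a), snd (e a)} \<inter> {fst (e b), snd (e b)} = {}"
      by (auto simp: e_def)
  qed (simp_all add: S_def)
  then have "is_double_star G \<lparr>pverts = pverts S \<union> x ` pverts G \<union> y ` pverts G, parcs = parcs S \<union> A \<union> A\<inverse>\<rparr>"
    unfolding is_double_star_def
    by (intro exI[of _ I] exI[of _ S] exI[of _ x] exI[of _ y] exI[of _ A])
      (auto simp: A_def S_def I_def x_def y_def inj_on_def)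
  then show ?thesis by blast
qed

lemma is_double_star_pair_graph:
  assumes "pair_graph G" "is_double_star G H"
  shows "pair_graph H"
proof -
  interpret pair_graph G by fact
  from assms(2) obtain I S x y A where S: "is_star G I S"
    and new: "x ` pverts G \<inter> y ` pverts G = {}" "(x ` pverts G \<union> y ` pverts G) \<inter> pverts S = {}"
    and A: "A = (\<Union>v\<in>pverts G. {(x v, y v)} \<union> {x v, y v} \<times> I v)"
    and H: "pverts H = pverts S \<union> x ` pverts G \<union> y ` pverts G" "parcs H = parcs S \<union> A \<union> A\<inverse>"
    unfolding is_double_star_def by (elim exE conjE) (rule that)
  from S obtain e where fin: "\<And>v. v \<in> pverts G \<Longrightarrow> finite (I v)"
    and dis: "disjoint_family_on I (pverts G)"
    and VS: "pverts S = (\<Union>v\<in>pverts G. I v)"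
    and e: "\<forall>(u, v)\<in>parcs G. e (u, v) \<in> I u \<times> I v \<and> e (v, u) = prod.swap (e (u, v))"
    and ES: "parcs S = e ` parcs G"
    unfolding is_star_def by (elim exE conjE) (rule that, auto)
  have finH: "finite (pverts H)" using fin by (simp add: H VS)
  have wfS: "a \<in> pverts S \<and> b \<in> pverts S \<and> a \<noteq> b \<and> (b, a) \<in> parcs S" if ab: "(a, b) \<in> parcs S" for a b
  proof -
    from ab obtain u v where uv: "(u, v) \<in> parcs G" "e (u, v) = (a, b)" unfolding ES by auto
    then have *: "a \<in> I u" "b \<in> I v" "e (v, u) = (b, a)" using e by fastforce+
    have "u \<in> pverts G" "v \<in> pverts G" "u \<noteq> v" "(v, u) \<in> parcs G"
      using uv(1) wellformed' no_loops' arcs_symmetric by auto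
    moreover from this have "I u \<inter> I v = {}" using dis by (simp add: disjoint_family_on_def)
    ultimately show ?thesis using * unfolding VS ES by (intro conjI) (blast, blast, blast, metis image_eqI)
  qed
  have wfA: "a \<in> pverts H \<and> b \<in> pverts H \<and> a \<noteq> b" if "(a, b) \<in> A" for a b
    using that new unfolding A H VS by auto
  have wf: "a \<in> pverts H \<and> b \<in> pverts H \<and> a \<noteq> b \<and> (b, a) \<in> parcs H" if "(a, b) \<in> parcs H" for a b
    using that wfS[of a b] wfA[of a b] wfA[of b a] unfolding H by blast
  have "finite (parcs H)"
    using wf by (intro finite_subset[OF _ finite_cartesian_product[OF finH finH]]) auto
  with finH wf show ?thesis
    by unfold_locales (auto simp: symmetric_def sym_def)
qed

end

theory Submission
  imports Defs
begin

text \<open>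
  Recoloring one vertex, or exchanging the colors of an edge whose other neighbors avoid both
  colors, is a Kempe change. These two moves suffice. If a color \<open>p\<close> is used on neither \<open>x\<^sub>v\<close> nor
  \<open>y\<^sub>v\<close>, then \<open>I\<^sub>v\<close> can be made monochromatic in \<open>p\<close>, because every matching edge at \<open>I\<^sub>v\<close> leaves
  its other end at least one color other than \<open>p\<close>. Then \<open>x\<^sub>v\<close> and \<open>y\<^sub>v\<close> see only \<open>p\<close> outside their own
  edge and can take any two other colors. In this way every coloring reaches one with \<open>x\<^sub>v = 3\<close> and
  \<open>y\<^sub>v = 4\<close> for all \<open>v\<close>, and two such colorings differ only by exchanges along matching edges.
\<close>

section \<open>Kempe changes\<close>

context pair_graph
begin

lemma coloringsD:
  assumes "c \<in> colorings G k"
  shows "v \<in> pverts G \<Longrightarrow> c v \<in> {1..k}" "(u, v) \<in> parcs G \<Longrightarrow> c u \<noteq> c v"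
  using assms unfolding colorings_def by (blast, fastforce)

lemma arcs_sym: "(u, v) \<in> parcs G \<Longrightarrow> (v, u) \<in> parcs G"
  using arcs_symmetric by blast

lemma dominates_induced_iff:
  "u \<rightarrow>\<^bsub>with_proj G \<restriction> W\<^esub> v \<longleftrightarrow> (u, v) \<in> parcs G \<and> u \<in> W \<and> v \<in> W"
  by (force simp: arcs_ends_def arc_to_ends_def)

lemma reachable_inducedI:
  assumes "(u, v) \<in> parcs G" "u \<in> W" "v \<in> W"
  shows "u \<rightarrow>\<^sup>*\<^bsub>with_proj G \<restriction> W\<^esub> v"
proof -
  have "u \<rightarrow>\<^bsub>with_proj G \<restriction> W\<^esub> v"
    using assms by (simp add: dominates_induced_iff)
  then show ?thesis
    unfolding reachable_def using assms(2,3)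
    by (intro rtrancl_on_into_rtrancl_on[OF rtrancl_on_refl]) (simp_all only: induce_subgraph_verts)
qed

lemma reachable_induced_closed:
  assumes "u \<rightarrow>\<^sup>*\<^bsub>with_proj G \<restriction> W\<^esub> v" "u \<in> K"
    and "\<And>s t. s \<in> K \<Longrightarrow> (s, t) \<in> parcs G \<Longrightarrow> t \<in> W \<Longrightarrow> t \<in> K"
  shows "v \<in> K"
proof -
  have "(u, v) \<in> rtrancl_on W (arcs_ends (with_proj G \<restriction> W))"
    using assms(1) by (simp add: reachable_def)
  then show ?thesis
    by (induction rule: rtrancl_on_induct)
      (use assms(2,3) dominates_induced_iff in blast)+
qed

section \<open>Kempe components, and Kempe changes as a symmetric relation on colorings\<close>

text \<open>A strong component is a nonempty, mutually reachable set that is maximal. Closure under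
  neighbors colored \<open>i\<close> or \<open>j\<close> yields maximality, since no path in the
  two-colored subgraph can then leave \<open>K\<close>.\<close>

lemma kempe_componentsI:
  assumes "K \<noteq> {}"
    and "\<And>u v. u \<in> K \<Longrightarrow> v \<in> K \<Longrightarrow> u \<rightarrow>\<^sup>*\<^bsub>with_proj G \<restriction> {v \<in> pverts G. c v \<in> {i, j}}\<^esub> v"
    and "\<And>u v. u \<in> K \<Longrightarrow> (u, v) \<in> parcs G \<Longrightarrow> c v \<in> {i, j} \<Longrightarrow> v \<in> K"
  shows "K \<in> kempe_components G c i j"
  unfolding kempe_components_def pre_digraph.sccs_verts_def
  using assms by (blast intro: reachable_induced_closed)

lemma kempe_components_subset:
  assumes "K \<in> kempe_components G c i j"
  shows "K \<subseteq> {v \<in> pverts G. c v \<in> {i, j}}"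
proof
  fix v assume "v \<in> K"
  then have "v \<rightarrow>\<^sup>*\<^bsub>with_proj G \<restriction> {v \<in> pverts G. c v \<in> {i, j}}\<^esub> v"
    using assms unfolding kempe_components_def pre_digraph.sccs_verts_def by blast
  then show "v \<in> {v \<in> pverts G. c v \<in> {i, j}}"
    by (elim reachable_in_vertsE) simp
qed

lemma kempe_components_closed:
  assumes "K \<in> kempe_components G c i j" "u \<in> K" "(u, v) \<in> parcs G" "c v \<in> {i, j}"
  shows "v \<in> K"
proof (rule ccontr)
  let ?D = "with_proj G \<restriction> {v \<in> pverts G. c v \<in> {i, j}}"
  assume "v \<notin> K"
  have "u \<in> pverts G" "c u \<in> {i, j}" "v \<in> pverts G"
    using assms(2,3) kempe_components_subset[OF assms(1)] wellformed' by blast+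
  then have "u \<rightarrow>\<^sup>*\<^bsub>?D\<^esub> v" "v \<rightarrow>\<^sup>*\<^bsub>?D\<^esub> u"
    using assms(3,4) arcs_sym by (auto intro!: reachable_inducedI)
  then show False
    using assms(1,2) \<open>v \<notin> K\<close> unfolding kempe_components_def pre_digraph.sccs_verts_def by blast
qed

text \<open>An edge leaving \<open>K\<close> ends in a color other than \<open>i\<close> and
  \<open>j\<close>, so only edges with both ends in \<open>K\<close> have both colors affected, and
  there the swap is injective.\<close>

lemma kempe_change_colorings:
  assumes "(c, d) \<in> kempe_change G k"
  shows "d \<in> colorings G k"
proof -
  obtain i j K where ij: "i \<in> {1..k}" "j \<in> {1..k}" "i \<noteq> j" and K: "K \<in> kempe_components G c i j"
    and d: "d = (\<lambda>v. if v \<in> K then transpose i j (c v) else c v)" and c: "c \<in> colorings G k"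
    using assms unfolding kempe_change_def by blast
  note sub = kempe_components_subset[OF K] and closed = kempe_components_closed[OF K]
  have "d \<in> pverts G \<rightarrow>\<^sub>E {1..k}"
    using c sub ij unfolding d colorings_def by (fastforce simp: PiE_iff extensional_def transpose_def)
  moreover have "d u \<noteq> d v" if "(u, v) \<in> parcs G" for u v
  proof -
    have "c u \<noteq> c v" using coloringsD[OF c] that by blast
    moreover have "u \<in> K \<longleftrightarrow> v \<in> K" if "c u \<in> {i, j}" "c v \<in> {i, j}"
      using closed[of u v] closed[of v u] that \<open>(u, v) \<in> parcs G\<close> arcs_sym by blast
    ultimately show ?thesis using sub unfolding d by (auto simp: transpose_def)
  qed
  ultimately show ?thesis unfolding colorings_def by blast
qed

text \<open>Swapping keeps the set of vertices colored \<open>i\<close> or \<open>j\<close>, so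
  \<open>K\<close> is still a component afterwards, and swapping it again undoes the change.\<close>

lemma sym_kempe_change: "sym (kempe_change G k)"
proof (rule symI)
  fix c d assume cd: "(c, d) \<in> kempe_change G k"
  then obtain i j K where ij: "i \<in> {1..k}" "j \<in> {1..k}" "i \<noteq> j" and K: "K \<in> kempe_components G c i j"
    and d: "d = (\<lambda>v. if v \<in> K then transpose i j (c v) else c v)"
    unfolding kempe_change_def by blast
  have "{v \<in> pverts G. d v \<in> {i, j}} = {v \<in> pverts G. c v \<in> {i, j}}"
    by (auto simp: d transpose_def split: if_splits)
  then have "K \<in> kempe_components G d i j"
    using K by (simp only: kempe_components_def)
  moreover have "c = (\<lambda>v. if v \<in> K then transpose i j (d v) else d v)"
    by (auto simp: d)
  ultimately show "(d, c) \<in> kempe_change G k"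
    using ij kempe_change_colorings[OF cd] unfolding kempe_change_def by blast
qed

lemma kempe_rtrancl_sym: "(c, d) \<in> (kempe_change G k)\<^sup>* \<Longrightarrow> (d, c) \<in> (kempe_change G k)\<^sup>*"
  using sym_rtrancl[OF sym_kempe_change] by (rule symD)

lemma kempe_rtrancl_colorings:
  "(c, d) \<in> (kempe_change G k)\<^sup>* \<Longrightarrow> c \<in> colorings G k \<Longrightarrow> d \<in> colorings G k"
  by (induction rule: rtrancl_induct) (auto intro: kempe_change_colorings)

section \<open>The two elementary moves\<close>

text \<open>Unless \<open>w\<close> already has color \<open>p\<close>, no neighbor of
  \<open>w\<close> has color \<open>c w\<close> or \<open>p\<close>, so \<open>{w}\<close> is a
  whole Kempe component.\<close>

lemma kempe_recolor:
  assumes c: "c \<in> colorings G k" and w: "w \<in> pverts G" and p: "p \<in> {1..k}"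
    and free: "\<And>z. (w, z) \<in> parcs G \<Longrightarrow> c z \<noteq> p"
  shows "(c, c(w := p)) \<in> (kempe_change G k)\<^sup>*"
proof (cases "c w = p")
  case True
  then have "c(w := p) = c" by auto
  then show ?thesis by simp
next
  case False
  have "{w} \<in> kempe_components G c (c w) p"
    using coloringsD[OF c] free w
    by (intro kempe_componentsI) (fastforce simp: reachable_def)+
  moreover have "c(w := p) = (\<lambda>v. if v \<in> {w} then transpose (c w) p (c v) else c v)" by auto
  ultimately have "(c, c(w := p)) \<in> kempe_change G k"
    using c p False coloringsD(1)[OF c w] unfolding kempe_change_def by blast
  then show ?thesis ..
qed

lemma kempe_swap:
  assumes c: "c \<in> colorings G k" and arc: "(w, w') \<in> parcs G"
    and free: "\<And>z. (w, z) \<in> parcs G \<Longrightarrow> z \<noteq> w' \<Longrightarrow> c z \<noteq> c w'"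
      "\<And>z. (w', z) \<in> parcs G \<Longrightarrow> z \<noteq> w \<Longrightarrow> c z \<noteq> c w"
  shows "(c, c(w := c w', w' := c w)) \<in> (kempe_change G k)\<^sup>*"
proof -
  let ?D = "with_proj G \<restriction> {v \<in> pverts G. c v \<in> {c w, c w'}}"
  have V: "w \<in> pverts G" "w' \<in> pverts G" and ne: "c w \<noteq> c w'"
    using arc wellformed' coloringsD[OF c] by blast+
  then have reach: "w \<rightarrow>\<^sup>*\<^bsub>?D\<^esub> w'" "w' \<rightarrow>\<^sup>*\<^bsub>?D\<^esub> w"
    using arc arcs_sym by (auto intro!: reachable_inducedI)
  \<comment> \<open>When \<open>u = v\<close>, reachability comes from crossing the edge and
    returning.\<close>
  have "u \<rightarrow>\<^sup>*\<^bsub>?D\<^esub> v" if "u \<in> {w, w'}" "v \<in> {w, w'}" for u v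
    using that reach rtrancl_on_trans[OF reach[unfolded reachable_def]]
      rtrancl_on_trans[OF reach(2,1)[unfolded reachable_def]]
    by (auto simp only: reachable_def)
  then have "{w, w'} \<in> kempe_components G c (c w) (c w')"
  proof (rule kempe_componentsI[rotated])
    fix u v assume "u \<in> {w, w'}" "(u, v) \<in> parcs G" "c v \<in> {c w, c w'}"
    then show "v \<in> {w, w'}" using free coloringsD(2)[OF c] by fastforce
  qed simp_all
  moreover have "c(w := c w', w' := c w) = (\<lambda>v. if v \<in> {w, w'} then transpose (c w) (c w') (c v) else c v)"
    using ne by auto
  ultimately have "(c, c(w := c w', w' := c w)) \<in> kempe_change G k"
    using c ne coloringsD(1)[OF c] V unfolding kempe_change_def by blast
  then show ?thesis ..
qed

end

section \<open>Colorings of the double star\<close>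

text \<open>\<open>V\<close> is the vertex set of the underlying graph, whose edges survive only
  through \<open>M\<close>. Each matching edge contributes both of its arcs to \<open>M\<close>, so
  \<open>M_unique\<close> and \<open>sym_M\<close> together express that the edges are
  vertex-disjoint.\<close>

locale double_star = pair_graph H for H :: "'b pair_pre_digraph" +
  fixes V :: "'a set" and I :: "'a \<Rightarrow> 'b set" and x y :: "'a \<Rightarrow> 'b" and M :: "('b \<times> 'b) set"
  assumes finite_V: "finite V"
    and verts_H: "pverts H = (\<Union>v\<in>V. I v) \<union> x ` V \<union> y ` V"
    and arcs_H: "parcs H = M \<union> (\<Union>v\<in>V. {(x v, y v)} \<union> {x v, y v} \<times> I v)
      \<union> (\<Union>v\<in>V. {(x v, y v)} \<union> {x v, y v} \<times> I v)\<inverse>"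
    and inj_x: "inj_on x V" and inj_y: "inj_on y V"
    and x_neq_y: "u \<in> V \<Longrightarrow> v \<in> V \<Longrightarrow> x u \<noteq> y v"
    and x_notin_I: "u \<in> V \<Longrightarrow> v \<in> V \<Longrightarrow> x u \<notin> I v"
    and y_notin_I: "u \<in> V \<Longrightarrow> v \<in> V \<Longrightarrow> y u \<notin> I v"
    and disjoint_I: "disjoint_family_on I V"
    and M_ends: "(w, w') \<in> M \<Longrightarrow> \<exists>u\<in>V. \<exists>v\<in>V. u \<noteq> v \<and> w \<in> I u \<and> w' \<in> I v"
    and M_unique: "(w, a) \<in> M \<Longrightarrow> (w, b) \<in> M \<Longrightarrow> a = b"
    and sym_M: "sym M"
begin

abbreviation kempe_reachable :: "('b \<Rightarrow> nat) \<Rightarrow> ('b \<Rightarrow> nat) \<Rightarrow> bool" (infix \<open>\<leadsto>\<close> 50) where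
  "c \<leadsto> d \<equiv> (c, d) \<in> (kempe_change H 4)\<^sup>*"

lemma I_inj: "w \<in> I u \<Longrightarrow> w \<in> I v \<Longrightarrow> u \<in> V \<Longrightarrow> v \<in> V \<Longrightarrow> u = v"
  using disjoint_I unfolding disjoint_family_on_def by blast

lemma in_verts:
  assumes "v \<in> V"
  shows "x v \<in> pverts H" "y v \<in> pverts H" "w \<in> I v \<Longrightarrow> w \<in> pverts H"
  using assms unfolding verts_H by auto

lemma arc_x_iff:
  assumes v: "v \<in> V"
  shows "(x v, z) \<in> parcs H \<longleftrightarrow> z = y v \<or> z \<in> I v"
  using v inj_onD[OF inj_x _ v] x_neq_y[OF v] x_notin_I[OF v] M_ends[of "x v" z]
  unfolding arcs_H by fastforce

lemma arc_y_iff: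
  assumes v: "v \<in> V"
  shows "(y v, z) \<in> parcs H \<longleftrightarrow> z = x v \<or> z \<in> I v"
  using v inj_onD[OF inj_y _ v] x_neq_y[OF _ v] y_notin_I[OF v] M_ends[of "y v" z]
  unfolding arcs_H by fastforce

lemma arc_I_iff:
  assumes v: "v \<in> V" and w: "w \<in> I v"
  shows "(w, z) \<in> parcs H \<longleftrightarrow> z = x v \<or> z = y v \<or> (w, z) \<in> M"
proof -
  have "w \<noteq> x u" "w \<noteq> y u" "w \<in> I u \<longleftrightarrow> u = v" if "u \<in> V" for u
    using x_notin_I[OF that v] y_notin_I[OF that v] I_inj[OF w _ v that] w by auto
  then show ?thesis using v
    unfolding arcs_H Un_iff converse_iff UN_iff insert_iff empty_iff mem_Sigma_iff prod.inject
    by blast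
qed

lemma colors_gadget:
  assumes "c \<in> colorings H 4" "v \<in> V"
  shows "c (x v) \<in> {1..4}" "c (y v) \<in> {1..4}" "c (x v) \<noteq> c (y v)"
    "w \<in> I v \<Longrightarrow> c w \<in> {1..4} - {c (x v), c (y v)}"
  using assms coloringsD[OF assms(1)] in_verts[OF assms(2)]
    arc_x_iff[OF assms(2)] arc_y_iff[OF assms(2)] by (blast, blast, blast, metis Diff_iff insertE empty_iff)

lemma colors_M: "c \<in> colorings H 4 \<Longrightarrow> (w, w') \<in> M \<Longrightarrow> c w \<noteq> c w'"
  using coloringsD(2) unfolding arcs_H by blast

lemma M_sym: "(w, w') \<in> M \<Longrightarrow> (w', w) \<in> M"
  using sym_M by (rule symD)

section \<open>Moves at matching edges, and making \<open>I v\<close> monochromatic\<close>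

lemma swap_matching_edge:
  assumes c: "c \<in> colorings H 4" and uv: "u \<in> V" "v \<in> V" "w \<in> I v" "w' \<in> I u" "(w, w') \<in> M"
    and "c w' \<notin> {c (x v), c (y v)}" "c w \<notin> {c (x u), c (y u)}"
  shows "c \<leadsto> c(w := c w', w' := c w)"
proof (rule kempe_swap[OF c])
  show "(w, w') \<in> parcs H" using uv arc_I_iff by blast
  show "c z \<noteq> c w'" if "(w, z) \<in> parcs H" "z \<noteq> w'" for z
    using that assms(7) arc_I_iff[OF uv(2,3)] M_unique[OF uv(5)] by auto
  show "c z \<noteq> c w" if "(w', z) \<in> parcs H" "z \<noteq> w" for z
    using that assms(8) arc_I_iff[OF uv(1,4)] M_unique[OF M_sym[OF uv(5)]] by auto
qed

text \<open>If the partner \<open>w'\<close> of \<open>w\<close> obstructs recoloring \<open>w\<close>, then either \<open>w'\<close> can first move to the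
  other color available to it, or that color is \<open>c w\<close> and the edge can be swapped.\<close>

lemma recolor_I:
  assumes c: "c \<in> colorings H 4" and v: "v \<in> V" and w: "w \<in> I v"
    and p: "p \<in> {1..4} - {c (x v), c (y v)}"
  obtains d where "c \<leadsto> d" "d w = p" "\<And>z. z \<in> I v \<Longrightarrow> z \<noteq> w \<Longrightarrow> d z = c z"
    "\<And>u. u \<in> V \<Longrightarrow> d (x u) = c (x u)" "\<And>u. u \<in> V \<Longrightarrow> d (y u) = c (y u)"
proof (cases "\<exists>w'. (w, w') \<in> M \<and> c w' = p")
  case False
  have "c \<leadsto> c(w := p)"
    using False p v w by (intro kempe_recolor[OF c]) (auto simp: arc_I_iff in_verts(3))
  then show ?thesis
    using that[of "c(w := p)"] x_notin_I y_notin_I v w by force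
next
  case True
  then obtain w' where M: "(w, w') \<in> M" and w'p: "c w' = p" by blast
  obtain u where u: "u \<in> V" "u \<noteq> v" "w' \<in> I u"
    using M_ends[OF M] I_inj[OF w _ v] by metis
  have x_fresh: "x t \<noteq> w" "x t \<noteq> w'" "y t \<noteq> w" "y t \<noteq> w'" if "t \<in> V" for t
    using x_notin_I y_notin_I that u v w by blast+
  have w'_notin: "w' \<notin> I v" using I_inj u v by blast
  have "w \<noteq> w'" using w w'_notin by blast
  show ?thesis
  proof (cases "c w \<in> {c (x u), c (y u)}")
    case False
    then have "c \<leadsto> c(w := c w', w' := c w)"
      using swap_matching_edge[OF c u(1) v w u(3) M] p w'p by auto
    then show ?thesis
      using that[of "c(w := c w', w' := c w)"] x_fresh w'_notin w'p \<open>w \<noteq> w'\<close> by force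
  next
    case True
    \<comment> \<open>Three values cannot exhaust four colors, so some \<open>r\<close> remains.
      Since \<open>c w\<close> occurs on \<open>x u\<close> or \<open>y u\<close>, \<open>r\<close>
      differs from \<open>c w\<close> as well: \<open>w'\<close> sees no \<open>r\<close> and can
      move there, which releases \<open>p\<close> for \<open>w\<close>.\<close>
    have "card {c (x u), c (y u), p} < card {1..4::nat}"
      by (simp add: card_insert_if)
    then have "\<not> {1..4::nat} \<subseteq> {c (x u), c (y u), p}"
      using card_mono[of "{c (x u), c (y u), p}" "{1..4::nat}"] by auto
    then obtain r where r: "r \<in> {1..4}" "r \<notin> {c (x u), c (y u), p}" by blast
    let ?c' = "c(w' := r)"
    have step: "c \<leadsto> ?c'"
      using r u True M_unique[OF M_sym[OF M]]
      by (intro kempe_recolor[OF c]) (auto simp: arc_I_iff in_verts(3))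
    then have "?c' \<in> colorings H 4" using kempe_rtrancl_colorings c by blast
    then have "?c' \<leadsto> ?c'(w := p)"
      using p v w r M_unique[OF M] x_fresh[OF v]
      by (intro kempe_recolor) (auto simp: arc_I_iff in_verts(3))
    with step have "c \<leadsto> ?c'(w := p)" by (rule rtrancl_trans)
    then show ?thesis
      using that[of "?c'(w := p)"] x_fresh w'_notin \<open>w \<noteq> w'\<close> by force
  qed
qed

text \<open>Each use of \<open>recolor_I\<close> corrects one vertex of \<open>I v\<close> and
  leaves the rest of \<open>I v\<close> alone, so the set of vertices not yet colored
  \<open>p\<close> shrinks. Other sets \<open>I u\<close> may be disturbed, but no
  \<open>x u\<close> or \<open>y u\<close> is, so \<open>p\<close> stays available.\<close>

lemma make_I_monochromatic:
  assumes c: "c \<in> colorings H 4" and v: "v \<in> V" and p: "p \<in> {1..4} - {c (x v), c (y v)}"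
  obtains d where "c \<leadsto> d" "\<And>z. z \<in> I v \<Longrightarrow> d z = p"
    "\<And>u. u \<in> V \<Longrightarrow> d (x u) = c (x u)" "\<And>u. u \<in> V \<Longrightarrow> d (y u) = c (y u)"
proof -
  have "finite {z \<in> I v. c z \<noteq> p}"
    using pair_finite_verts v by (rule_tac finite_subset[of _ "pverts H"]) (auto simp: in_verts)
  then have "\<exists>d. c \<leadsto> d \<and> (\<forall>z\<in>I v. d z = p) \<and> (\<forall>u\<in>V. d (x u) = c (x u) \<and> d (y u) = c (y u))"
    using c p
  proof (induction "{z \<in> I v. c z \<noteq> p}" arbitrary: c rule: finite_psubset_induct)
    case psubset
    show ?case
    proof (cases "\<forall>z\<in>I v. c z = p")
      case True
      then show ?thesis by blast
    next
      case False
      then obtain w where w: "w \<in> I v" "c w \<noteq> p" by blast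
      obtain d where d: "c \<leadsto> d" "d w = p" "\<And>z. z \<in> I v \<Longrightarrow> z \<noteq> w \<Longrightarrow> d z = c z"
        "\<And>u. u \<in> V \<Longrightarrow> d (x u) = c (x u)" "\<And>u. u \<in> V \<Longrightarrow> d (y u) = c (y u)"
        using recolor_I[OF psubset.prems(1) v w(1) psubset.prems(2)] by blast
      have "{z \<in> I v. d z \<noteq> p} \<subset> {z \<in> I v. c z \<noteq> p}" using d(2,3) w by force
      moreover have "d \<in> colorings H 4"
        using kempe_rtrancl_colorings[OF d(1) psubset.prems(1)] .
      moreover have "p \<in> {1..4} - {d (x v), d (y v)}" using psubset.prems(2) d(4,5) v by simp
      ultimately obtain e where "d \<leadsto> e" "\<forall>z\<in>I v. e z = p"
        "\<forall>u\<in>V. e (x u) = d (x u) \<and> e (y u) = d (y u)"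
        using psubset.hyps(2)[of d] by blast
      then show ?thesis using d(1,4,5) by (intro exI[of _ e]) (auto intro: rtrancl_trans)
    qed
  qed
  then show ?thesis using that by blast
qed

section \<open>Prescribing the colors of \<open>x v\<close> and \<open>y v\<close>\<close>

text \<open>Outside their common edge both vertices see only \<open>p\<close>. Normally
  \<open>x v\<close> takes \<open>a\<close> first and \<open>y v\<close> then takes
  \<open>b\<close>. If \<open>y v\<close> already holds \<open>a\<close>, the edge between them is
  swapped first: \<open>I v\<close> avoids both of its colors.\<close>

lemma recolor_xy:
  assumes c: "c \<in> colorings H 4" and v: "v \<in> V" and mono: "\<And>z. z \<in> I v \<Longrightarrow> c z = p"
    and ab: "a \<in> {1..4} - {p}" "b \<in> {1..4} - {p}" "a \<noteq> b"
  shows "c \<leadsto> c(x v := a, y v := b)"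
proof -
  note fresh = x_notin_I[OF v v] y_notin_I[OF v v] x_neq_y[OF v v]
  have y_step: "d \<leadsto> d(y v := b)"
    if "d \<in> colorings H 4" "\<And>z. z \<in> I v \<Longrightarrow> d z = p" "d (x v) = a" for d
    using that ab v by (intro kempe_recolor) (auto simp: arc_y_iff in_verts)
  obtain d where d: "c \<leadsto> d" "d (x v) = a" "\<And>z. z \<noteq> x v \<Longrightarrow> z \<noteq> y v \<Longrightarrow> d z = c z"
  proof (cases "c (y v) = a")
    case False
    then have "c \<leadsto> c(x v := a)"
      using mono ab v by (intro kempe_recolor[OF c]) (auto simp: arc_x_iff in_verts)
    then show ?thesis using that by force
  next
    case True
    have "c z \<noteq> c (x v) \<and> c z \<noteq> c (y v)" if "z \<in> I v" for z
      using colors_gadget(4)[OF c v that] by blast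
    then have "c \<leadsto> c(x v := c (y v), y v := c (x v))"
      using v by (intro kempe_swap[OF c]) (auto simp: arc_x_iff arc_y_iff)
    then show ?thesis using that True fresh(3) by force
  qed
  have "d z = p" if "z \<in> I v" for z using d(3)[of z] mono fresh that by metis
  with y_step kempe_rtrancl_colorings[OF d(1) c] d(2) have "d \<leadsto> d(y v := b)" by blast
  moreover have "d(y v := b) = c(x v := a, y v := b)"
    using d(2,3) fresh(3) by (intro ext) auto
  ultimately show ?thesis using d(1) by (metis rtrancl_trans)
qed

lemma change_xy:
  assumes c: "c \<in> colorings H 4" and v: "v \<in> V" and p: "p \<in> {1..4} - {c (x v), c (y v)}"
    and ab: "a \<in> {1..4} - {p}" "b \<in> {1..4} - {p}" "a \<noteq> b"
  obtains d where "c \<leadsto> d" "d (x v) = a" "d (y v) = b"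
    "\<And>u. u \<in> V \<Longrightarrow> u \<noteq> v \<Longrightarrow> d (x u) = c (x u)" "\<And>u. u \<in> V \<Longrightarrow> u \<noteq> v \<Longrightarrow> d (y u) = c (y u)"
proof -
  obtain d where d: "c \<leadsto> d" "\<And>z. z \<in> I v \<Longrightarrow> d z = p"
    "\<And>u. u \<in> V \<Longrightarrow> d (x u) = c (x u)" "\<And>u. u \<in> V \<Longrightarrow> d (y u) = c (y u)"
    using make_I_monochromatic[OF c v p] by blast
  let ?e = "d(x v := a, y v := b)"
  have "d \<leadsto> ?e"
    using recolor_xy[OF kempe_rtrancl_colorings[OF d(1) c] v d(2) ab] by blast
  then have "c \<leadsto> ?e" using d(1) by (metis rtrancl_trans)
  moreover have "x u \<noteq> x v \<and> y u \<noteq> y v \<and> x u \<noteq> y v \<and> y u \<noteq> x v" if "u \<in> V" "u \<noteq> v" for u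
    using that v inj_onD[OF inj_x] inj_onD[OF inj_y] x_neq_y by metis
  ultimately show ?thesis
    using that[of ?e] d(3,4) x_neq_y[OF v v] by simp
qed

text \<open>A direct change to 3 and 4 needs a \<open>p\<close> in {1, 2} that is absent from both
  \<open>x v\<close> and \<open>y v\<close>.\<close>

lemma normalize_xy:
  assumes c: "c \<in> colorings H 4" and v: "v \<in> V"
  obtains d where "c \<leadsto> d" "d (x v) = 3" "d (y v) = 4"
    "\<And>u. u \<in> V \<Longrightarrow> u \<noteq> v \<Longrightarrow> d (x u) = c (x u)" "\<And>u. u \<in> V \<Longrightarrow> u \<noteq> v \<Longrightarrow> d (y u) = c (y u)"
proof (cases "\<exists>p\<in>{1,2}. p \<notin> {c (x v), c (y v)}")
  case True
  then obtain p where "p \<in> {1, 2}" "p \<notin> {c (x v), c (y v)}" by blast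
  then have "p \<in> {1..4} - {c (x v), c (y v)}" "3 \<in> {1..4} - {p}" "4 \<in> {1..4} - {p}"
    by auto
  from change_xy[OF c v this] that show ?thesis by simp blast
next
  case False
  \<comment> \<open>Now \<open>x v\<close> and \<open>y v\<close> carry exactly the colors 1 and 2.
    With \<open>I v\<close> colored 3 they can pass to 2 and 4, which frees 1 for \<open>I v\<close>
    and permits the change to 3 and 4.\<close>
  then have 3: "3 \<in> {1..4} - {c (x v), c (y v)}" by auto
  obtain d where d: "c \<leadsto> d" "d (x v) = 2" "d (y v) = 4"
    "\<And>u. u \<in> V \<Longrightarrow> u \<noteq> v \<Longrightarrow> d (x u) = c (x u)" "\<And>u. u \<in> V \<Longrightarrow> u \<noteq> v \<Longrightarrow> d (y u) = c (y u)"
    by (rule change_xy[OF c v 3, of 2 4]) auto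
  obtain e where "d \<leadsto> e" "e (x v) = 3" "e (y v) = 4"
    "\<And>u. u \<in> V \<Longrightarrow> u \<noteq> v \<Longrightarrow> e (x u) = d (x u)" "\<And>u. u \<in> V \<Longrightarrow> u \<noteq> v \<Longrightarrow> e (y u) = d (y u)"
    by (rule change_xy[OF kempe_rtrancl_colorings[OF d(1) c] v, of 1 3 4]) (auto simp: d(2,3))
  then show ?thesis using that[of e] d(1,4,5) by (metis rtrancl_trans)
qed

section \<open>Normalized colorings\<close>

lemma normalize:
  assumes c: "c \<in> colorings H 4"
  obtains d where "c \<leadsto> d" "\<And>v. v \<in> V \<Longrightarrow> d (x v) = 3 \<and> d (y v) = 4"
proof -
  have "\<exists>d. c \<leadsto> d \<and> (\<forall>v\<in>W. d (x v) = 3 \<and> d (y v) = 4)" if "finite W" "W \<subseteq> V" for W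
    using that
  proof induction
    case (insert v W)
    then obtain d where d: "c \<leadsto> d" "\<forall>v\<in>W. d (x v) = 3 \<and> d (y v) = 4" by blast
    obtain e where "d \<leadsto> e" "e (x v) = 3" "e (y v) = 4"
      "\<And>u. u \<in> V \<Longrightarrow> u \<noteq> v \<Longrightarrow> e (x u) = d (x u)" "\<And>u. u \<in> V \<Longrightarrow> u \<noteq> v \<Longrightarrow> e (y u) = d (y u)"
      using normalize_xy[OF kempe_rtrancl_colorings[OF d(1) c], of v] insert.prems by blast
    then have "e (x u) = 3 \<and> e (y u) = 4" if "u \<in> insert v W" for u
      using that d(2) insert.prems by (cases "u = v") auto
    moreover have "c \<leadsto> e" using d(1) \<open>d \<leadsto> e\<close> by (rule rtrancl_trans)
    ultimately show ?case by blast
  qed blast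
  from this[OF finite_V subset_refl] show ?thesis using that by blast
qed

text \<open>In both colorings every \<open>I v\<close> uses only 1 and 2, so each matching edge
  carries both colors in one of two orders. Correcting an edge, or an unmatched vertex, creates no
  new disagreement, so induction on the set of disagreements applies.\<close>

lemma normalized_reachable:
  assumes "c \<in> colorings H 4" "d \<in> colorings H 4"
    and "\<And>v. v \<in> V \<Longrightarrow> c (x v) = 3 \<and> c (y v) = 4"
    and d: "\<And>v. v \<in> V \<Longrightarrow> d (x v) = 3 \<and> d (y v) = 4"
  shows "c \<leadsto> d"
proof -
  have "finite {z \<in> pverts H. c z \<noteq> d z}" using pair_finite_verts by simp
  then show ?thesis
    using assms(1,3)
  proof (induction "{z \<in> pverts H. c z \<noteq> d z}" arbitrary: c rule: finite_psubset_induct)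
    case psubset
    note c = psubset.prems
    have two: "e w \<in> {1, 2}" if "e \<in> colorings H 4" "v \<in> V" "w \<in> I v" "e (x v) = 3 \<and> e (y v) = 4" for e v w
      using colors_gadget(4)[OF that(1-3)] that(4) by auto
    show ?case
    proof (cases "c = d")
      case False
      \<comment> \<open>Extensionality makes the colorings agree off the graph, so they differ at a
        vertex; as they agree on all \<open>x v\<close> and \<open>y v\<close>, it lies in some
        \<open>I v\<close>.\<close>
      have "c z = d z" if "z \<notin> pverts H" for z
        using c(1) assms(2) that unfolding colorings_def PiE_def extensional_def by auto
      with False obtain w where w: "w \<in> pverts H" "c w \<noteq> d w" by blast
      then obtain v where v: "v \<in> V" "w \<in> I v" using c(2) d unfolding verts_H by auto
      have cw: "c w \<in> {1, 2}" "d w \<in> {1, 2}" using two c d v assms(2) by blast+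
      have fresh: "x t \<noteq> z" "y t \<noteq> z" if "t \<in> V" "u \<in> V" "z \<in> I u" for t u z
        using x_notin_I y_notin_I that by blast+
      \<comment> \<open>It suffices to reach a normalized \<open>e\<close> that agrees with
        \<open>d\<close> at \<open>w\<close> and disagrees with \<open>d\<close> only where
        \<open>c\<close> did.\<close>
      have finish: ?thesis
        if "c \<leadsto> e" "e w = d w" "\<And>z. e z \<noteq> d z \<Longrightarrow> c z \<noteq> d z"
          "\<And>v. v \<in> V \<Longrightarrow> e (x v) = 3 \<and> e (y v) = 4" for e
      proof -
        have "{z \<in> pverts H. e z \<noteq> d z} \<subset> {z \<in> pverts H. c z \<noteq> d z}" using that w by blast
        then have "e \<leadsto> d" using psubset.hyps(2) that(4) kempe_rtrancl_colorings[OF that(1) c(1)] by blast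
        with that(1) show ?thesis by (rule rtrancl_trans)
      qed
      show ?thesis
      proof (cases "\<exists>w'. (w, w') \<in> M")
        case False
        then have "c \<leadsto> c(w := d w)"
          using cw c(2) v w coloringsD(1)[OF assms(2)]
          by (intro kempe_recolor[OF c(1)]) (auto simp: arc_I_iff)
        then show ?thesis using c(2) v by (intro finish[of "c(w := d w)"]) (auto simp: fresh split: if_splits)
      next
        case True
        then obtain w' where M: "(w, w') \<in> M" by blast
        then obtain u where u: "u \<in> V" "w' \<in> I u" using M_ends by blast
        have "c w' \<in> {1, 2}" "d w' \<in> {1, 2}" using two c d u assms(2) by blast+
        moreover have "c w \<noteq> c w'" "d w \<noteq> d w'" using colors_M M c(1) assms(2) by blast+
        \<comment> \<open>With only two colors available, a disagreement at \<open>w\<close> forces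
          the reverse order on the whole edge, so one swap repairs both ends.\<close>
        ultimately have flip: "c w' = d w" "c w = d w'" using cw w(2) by auto
        have "c \<leadsto> c(w := c w', w' := c w)"
          using cw flip c(2) u v by (intro swap_matching_edge[OF c(1) u(1) v u(2) M]) auto
        then show ?thesis using c(2) u v flip \<open>d w \<noteq> d w'\<close>
          by (intro finish[of "c(w := c w', w' := c w)"]) (auto simp: fresh split: if_splits)
      qed
    qed simp
  qed
qed

section \<open>Existence of a coloring, and equivalence of any two\<close>

text \<open>This rules out zero classes. The \<open>x v\<close> get 3, the \<open>y v\<close> get 4,
  and the ends of a matching edge get 1 and 2; the injective numbering \<open>f\<close> decides
  which end gets 1. The value \<open>undefined\<close> off the graph keeps \<open>c\<close>
  extensional.\<close>

lemma colorings_nonempty: "colorings H 4 \<noteq> {}"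
proof -
  obtain f :: "'b \<Rightarrow> nat" where f: "inj_on f (pverts H)"
    using finite_imp_inj_to_nat_seg[OF pair_finite_verts] by blast
  define c :: "'b \<Rightarrow> nat" where "c z =
    (if z \<notin> pverts H then undefined else if z \<in> x ` V then 3 else if z \<in> y ` V then 4
     else if \<exists>z'. (z, z') \<in> M \<and> f z < f z' then 1 else 2)" for z
  have c_x: "c (x v) = 3" and c_y: "c (y v) = 4" if "v \<in> V" for v
    using that in_verts[OF that] x_neq_y x_neq_y[THEN not_sym] unfolding c_def by auto
  have c_I: "c w = (if \<exists>z'. (w, z') \<in> M \<and> f w < f z' then 1 else 2)" if "v \<in> V" "w \<in> I v" for v w
    using that in_verts(3) x_notin_I y_notin_I unfolding c_def by auto
  have "c a \<noteq> c b" if M: "(a, b) \<in> M" for a b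
  proof -
    obtain u v where uv: "u \<in> V" "v \<in> V" "u \<noteq> v" "a \<in> I u" "b \<in> I v"
      using M_ends[OF M] by blast
    then have "f a \<noteq> f b" using inj_onD[OF f] in_verts(3) I_inj by metis
    moreover have "(\<exists>z. (a, z) \<in> M \<and> f a < f z) \<longleftrightarrow> f a < f b"
      "(\<exists>z. (b, z) \<in> M \<and> f b < f z) \<longleftrightarrow> f b < f a"
      using M M_sym[OF M] M_unique by blast+
    ultimately show ?thesis
      unfolding c_I[OF uv(1,4)] c_I[OF uv(2,5)] by simp
  qed
  moreover have "c a \<noteq> c b" if "v \<in> V" "a \<in> {x v, y v}" "b \<in> I v" for v a b
    using that c_x c_y c_I by auto
  ultimately have "c a \<noteq> c b" if "(a, b) \<in> parcs H" for a b
    using that c_x c_y unfolding arcs_H by fastforce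
  moreover have "c \<in> pverts H \<rightarrow>\<^sub>E {1..4}"
    by (auto simp: c_def)
  ultimately show ?thesis unfolding colorings_def by blast
qed

lemma colorings_reachable:
  assumes "c \<in> colorings H 4" "d \<in> colorings H 4"
  shows "c \<leadsto> d"
proof -
  obtain c' where c': "c \<leadsto> c'" "\<And>v. v \<in> V \<Longrightarrow> c' (x v) = 3 \<and> c' (y v) = 4"
    using normalize[OF assms(1)] by blast
  obtain d' where d': "d \<leadsto> d'" "\<And>v. v \<in> V \<Longrightarrow> d' (x v) = 3 \<and> d' (y v) = 4"
    using normalize[OF assms(2)] by blast
  have "c' \<leadsto> d'"
    using normalized_reachable kempe_rtrancl_colorings assms c' d' by blast
  then show ?thesis
    using c'(1) kempe_rtrancl_sym[OF d'(1)] by (meson rtrancl_trans)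
qed

end

section \<open>From the relational construction to the locale, and the count of classes\<close>

text \<open>The matching \<open>M\<close> is the arc set of \<open>S\<close>, and its properties are
  read off the arc map \<open>e\<close>.\<close>

lemma is_double_star_imp_double_star:
  fixes G :: "'a pair_pre_digraph" and H :: "'b pair_pre_digraph"
  assumes G: "pair_graph G" and H: "is_double_star G H"
  obtains I x y M where "double_star H (pverts G) I x y M"
proof -
  interpret pair_graph G by fact
  interpret H: pair_graph H using is_double_star_pair_graph assms by blast
  from H obtain I S x y A where S: "is_star G I S"
    and inj: "inj_on x (pverts G)" "inj_on y (pverts G)"
    and new: "x ` pverts G \<inter> y ` pverts G = {}" "(x ` pverts G \<union> y ` pverts G) \<inter> pverts S = {}"
    and A: "A = (\<Union>v\<in>pverts G. {(x v, y v)} \<union> {x v, y v} \<times> I v)"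
    and VH: "pverts H = pverts S \<union> x ` pverts G \<union> y ` pverts G" and EH: "parcs H = parcs S \<union> A \<union> A\<inverse>"
    unfolding is_double_star_def by (elim exE conjE) (rule that)
  from S obtain e where dis: "disjoint_family_on I (pverts G)"
    and VS: "pverts S = (\<Union>v\<in>pverts G. I v)"
    and e: "\<forall>(u, v)\<in>parcs G. e (u, v) \<in> I u \<times> I v \<and> e (v, u) = prod.swap (e (u, v))"
    and e_dis: "\<forall>a\<in>parcs G. \<forall>b\<in>parcs G. b \<noteq> a \<and> b \<noteq> prod.swap a \<longrightarrow>
             {fst (e a), snd (e a)} \<inter> {fst (e b), snd (e b)} = {}"
    and ES: "parcs S = e ` parcs G"
    unfolding is_star_def by (elim exE conjE) (rule that, auto)
  have eE: "\<exists>u v. (u, v) \<in> parcs G \<and> e (u, v) = (w, w') \<and> u \<in> pverts G \<and> v \<in> pverts G \<and> u \<noteq> v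
      \<and> w \<in> I u \<and> w' \<in> I v \<and> e (v, u) = (w', w)" if ww': "(w, w') \<in> parcs S" for w w'
  proof -
    from ww' obtain u v where "(u, v) \<in> parcs G" "e (u, v) = (w, w')" unfolding ES by auto
    moreover from this have "w \<in> I u" "w' \<in> I v" "e (v, u) = (w', w)" using e by fastforce+
    moreover have "u \<in> pverts G" "v \<in> pverts G" "u \<noteq> v"
      using calculation(1) wellformed' no_loops' by auto
    ultimately show ?thesis by blast
  qed
  have "double_star H (pverts G) I x y (parcs S)"
  proof unfold_locales
    show "finite (pverts G)" by (rule pair_finite_verts)
    show "pverts H = (\<Union>v\<in>pverts G. I v) \<union> x ` pverts G \<union> y ` pverts G" unfolding VH VS ..
    show "parcs H = parcs S \<union> (\<Union>v\<in>pverts G. {(x v, y v)} \<union> {x v, y v} \<times> I v)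
        \<union> (\<Union>v\<in>pverts G. {(x v, y v)} \<union> {x v, y v} \<times> I v)\<inverse>"
      unfolding EH A ..
    show "x u \<noteq> y v" "x u \<notin> I v" "y u \<notin> I v" if "u \<in> pverts G" "v \<in> pverts G" for u v
      using that new unfolding VS by blast+
    show "\<exists>u\<in>pverts G. \<exists>v\<in>pverts G. u \<noteq> v \<and> w \<in> I u \<and> w' \<in> I v" if "(w, w') \<in> parcs S" for w w'
      using eE[OF that] by blast
    show "sym (parcs S)"
    proof (rule symI)
      fix w w' assume "(w, w') \<in> parcs S"
      then show "(w', w) \<in> parcs S"
        using eE arcs_symmetric unfolding ES by (metis image_eqI)
    qed
    show "a = b" if ab: "(w, a) \<in> parcs S" "(w, b) \<in> parcs S" for w a b
    proof -
      obtain u v where uv: "(u, v) \<in> parcs G" "e (u, v) = (w, a)" "u \<in> pverts G" "w \<in> I u"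
        using eE[OF ab(1)] by blast
      obtain s t where st: "(s, t) \<in> parcs G" "e (s, t) = (w, b)" "s \<in> pverts G" "w \<in> I s"
        using eE[OF ab(2)] by blast
      \<comment> \<open>Both arcs start at \<open>w\<close>, so their preimages under
        \<open>e\<close> start at the same vertex of \<open>G\<close>. Since the arcs share
        \<open>w\<close>, disjointness makes the preimages equal or reverse, and a reversal would
        force \<open>u = v\<close>.\<close>
      have "u = s" using dis uv(3,4) st(3,4) unfolding disjoint_family_on_def by blast
      moreover have "u \<noteq> v" using uv(1) no_loops' by blast
      moreover have "(s, t) = (u, v) \<or> (s, t) = (v, u)"
        using e_dis uv(1,2) st(1,2) by force
      ultimately show ?thesis using uv(2) st(2) by auto
    qed
  qed (use inj dis in auto)
  then show ?thesis by (rule that)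
qed

theorem theorem4:
  fixes G :: "'a pair_pre_digraph" and H :: "'b pair_pre_digraph"
  assumes "pair_graph G" and "Digraph_Component.connected (with_proj G)"
    and "is_double_star G H"
  shows "Kc H 4 = 1 \<and> (\<forall>c\<in>colorings H 4. \<forall>d\<in>colorings H 4. (c, d) \<in> kempe_equiv H 4)"
proof -
  obtain I x y M where "double_star H (pverts G) I x y M"
    using is_double_star_imp_double_star assms(1,3) by blast
  then interpret double_star H "pverts G" I x y M .
  have eq: "kempe_equiv H 4 = colorings H 4 \<times> colorings H 4"
    unfolding kempe_equiv_def using colorings_reachable by blast
  \<comment> \<open>The full relation on a nonempty set has exactly one class.\<close>
  have "colorings H 4 // kempe_equiv H 4 = {colorings H 4}"
    unfolding eq quotient_def using colorings_nonempty by auto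
  then show ?thesis unfolding Kc_def eq by simp
qed

end
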